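(* Let $r$ be a positive integer and $p$ a prime. Suppose $f(x)=a_dx^d+\dots+a_0\in\mathbb{Q}[x]$ (with $a_d\neq 0$) is not $p^r$-pure and $d>r$. Then $f$ is eventually $p^r$-pure if and only if the following conditions hold: (i) $d=p^m$ for some $m\ge 1$; (ii) $\nu_p(a_d)=\nu_p(a_0)=0$ and $\nu_p(a_i)\ge 1$ for all $1\le i\le d-1$ (i.e. $f(x)\equiv a_dx^d+a_0 \pmod p$); (iii) $f(x+c)$ is $p^r$-pure for some $c\in\mathbb{Q}$. Moreover, the least integer $n>1$ such that $f^n$ is $p^r$-pure is $n=p$ if $a_d\equiv 1\pmod p$, and $n=\operatorname{ord}_p(a_d)$ otherwise.
   Context: $\nu_p$ denotes the $p$-adic valuation on $\mathbb{Q}$ (with $\nu_p(0)=\infty$). A polynomial $g(x)=b_ex^e+\dots+b_0\in\mathbb{Q}[x]$ of degree $e$ is $p^r$-pure if $\nu_p(b_e)=0$, $\nu_p(b_0)=r$, and $\frac{\nu_p(b_i)}{e-i}\ge\frac{r}{e}$ for all $1\le i\le e-1$. $f^n$ denotes the $n$-fold composition of $f$. A polynomial $f$ is eventually $p^r$-pure if $f^n$ is $p^r$-pure for some $n\ge1$. For $a\in\mathbb{Q}$ with $\nu_p(a)=0$, $\operatorname{ord}_p(a)$ is the multiplicative order of $a$ modulo $p$. *)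

theory Defs
  imports "HOL-Library.Extended_Real" "HOL-Computational_Algebra.Computational_Algebra"
begin

definition padic_val :: "nat \<Rightarrow> rat \<Rightarrow> ereal" where
  "padic_val p x =
     (if x = 0 then \<infinity>
      else ereal (real (multiplicity (int p) (fst (quotient_of x)))
                  - real (multiplicity (int p) (snd (quotient_of x)))))"

text \<open>Congruence modulo \<open>p\<close> in the localization of the integers at \<open>p\<close>: \<open>a - b\<close> lies in its maximal ideal.\<close>

definition padic_cong :: "nat \<Rightarrow> rat \<Rightarrow> rat \<Rightarrow> bool" where
  "padic_cong p a b \<longleftrightarrow> padic_val p (a - b) \<ge> 1"

text \<open>Meaningful only if \<open>padic_val p a = 0\<close>; otherwise no such exponent exists and the
  value is unspecified.\<close>

definition padic_ord :: "nat \<Rightarrow> rat \<Rightarrow> nat" where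
  "padic_ord p a = (LEAST k. k \<ge> 1 \<and> padic_cong p (a ^ k) 1)"

text \<open>The inequality is taken in the extended reals, so vanishing coefficients satisfy it.\<close>

definition pure_poly :: "nat \<Rightarrow> nat \<Rightarrow> rat poly \<Rightarrow> bool" where
  "pure_poly p r g \<longleftrightarrow>
     padic_val p (lead_coeff g) = 0 \<and>
     padic_val p (coeff g 0) = ereal (real r) \<and>
     (\<forall>i\<in>{1..degree g - 1}.
        padic_val p (coeff g i) / ereal (real (degree g - i)) \<ge> ereal (real r / real (degree g)))"

definition poly_iterate :: "'a::comm_semiring_1 poly \<Rightarrow> nat \<Rightarrow> 'a poly" where
  "poly_iterate f n = (pcompose f ^^ n) [:0, 1:]"

definition eventually_pure :: "nat \<Rightarrow> nat \<Rightarrow> rat poly \<Rightarrow> bool" where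
  "eventually_pure p r f \<longleftrightarrow> (\<exists>n\<ge>1. pure_poly p r (poly_iterate f n))"

end

theory Submission
  imports Defs "HOL-Number_Theory.Cong" "HOL-Algebra.Exponent"
begin

text \<open>
  The left endpoint of the part of the Newton polygon of a polynomial lying on a supporting line of
  given slope behaves multiplicatively under composition. If \<open>f\<^sup>n\<close> is pure, its polygon is a single
  segment, which constrains every way of writing \<open>f\<^sup>n\<close> as a composition. With positive slopes this
  shows that \<open>f\<close> is integral at \<open>p\<close>. With slope zero it shows that \<open>f - f(0)\<close>, \<open>f(x + b) - f(b)\<close>
  for \<open>b = f(0)\<close>, and \<open>f\<^sup>n\<^sup>-\<^sup>1 - c\<close> for \<open>c = f\<^sup>n\<^sup>-\<^sup>1(0)\<close> are monomials modulo \<open>p\<close>; as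
  \<open>f(x + b)\<close> and \<open>f(x)\<close> are both binomials modulo \<open>p\<close>, the degree is a power of \<open>p\<close> unless \<open>p\<close>
  divides \<open>b\<close>. With the slope of a hypothetical segment of \<open>f(x + c)\<close> too flat for purity it shows
  that \<open>f(x + c)\<close> is pure; here \<open>d > r\<close> makes the valuations \<open>\<ge> 1\<close> of the
  coefficients of \<open>f\<^sup>n\<^sup>-\<^sup>1 - c\<close> negligible.

  Conversely \<open>f(x) = a x + b\<close> modulo \<open>p\<close> as a function, since \<open>d\<close> is a power of \<open>p\<close>. Hence
  \<open>f\<^sup>n(0) = b (1 + a + \<dots> + a\<^sup>n\<^sup>-\<^sup>1)\<close> modulo \<open>p\<close>, and \<open>f\<^sup>n\<close> is pure exactly when this vanishes:
  then \<open>f\<^sup>n\<^sup>-\<^sup>1(0)\<close> is congruent to the \<open>c\<close> of condition (iii), purity of \<open>f(x + c)\<close> depends only on \<open>c\<close>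
  modulo \<open>p\<close>, and composing with \<open>f\<^sup>n\<^sup>-\<^sup>1 - f\<^sup>n\<^sup>-\<^sup>1(0)\<close> preserves purity.
\<close>

subsection \<open>Valuations of rational numbers\<close>

context
  fixes p :: nat
  assumes prime_p: "prime p"
begin

abbreviation (input) v :: "rat \<Rightarrow> ereal" where "v \<equiv> padic_val p"

lemma prime_elem_int_p: "prime_elem (int p)"
  using prime_p by simp

lemma padic_val_zero [simp]: "v 0 = \<infinity>"
  by (simp add: padic_val_def)

text \<open>Frees the valuation from the reduced fraction in its definition: cross-multiplying two
  fractions for one number turns equality into additivity of multiplicities.\<close>

lemma padic_val_fraction:
  assumes "a \<noteq> 0" "n \<noteq> 0"
  shows "v (of_int a / of_int n)
    = ereal (real (multiplicity (int p) a) - real (multiplicity (int p) n))"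
proof -
  obtain a' n' where q: "quotient_of (of_int a / of_int n) = (a', n')" by force
  from quotient_of_denom_pos[OF q] have n': "n' > 0" .
  from quotient_of_div[OF q] have eq: "(of_int a / of_int n :: rat) = of_int a' / of_int n'" .
  with assms n' have "(of_int (a * n') :: rat) = of_int (a' * n)"
    by (simp add: field_simps)
  hence e: "a * n' = a' * n" by (simp only: of_int_eq_iff)
  have a': "a' \<noteq> 0" using e assms n' by auto
  have "multiplicity (int p) a + multiplicity (int p) n'
      = multiplicity (int p) a' + multiplicity (int p) n"
    using e assms n' a' prime_elem_multiplicity_mult_distrib[OF prime_elem_int_p]
    by (metis less_irrefl)
  thus ?thesis using q assms by (simp add: padic_val_def)
qed

lemma rat_fractionE:
  fixes x :: rat
  assumes "x \<noteq> 0"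
  obtains a n where "a \<noteq> 0" "n \<noteq> 0" "x = of_int a / of_int n"
proof -
  obtain a n where q: "quotient_of x = (a, n)" by force
  show ?thesis
    using that[of a n] quotient_of_denom_pos[OF q] quotient_of_div[OF q] assms by force
qed

lemma padic_val_eq_int:
  assumes "x \<noteq> 0"
  obtains k :: int where "v x = ereal (of_int k)"
proof -
  from assms have "v x = ereal (of_int (int (multiplicity (int p) (fst (quotient_of x)))
      - int (multiplicity (int p) (snd (quotient_of x)))))"
    by (simp add: padic_val_def)
  thus ?thesis by (rule that)
qed

lemma padic_val_of_int:
  "a \<noteq> 0 \<Longrightarrow> v (of_int a) = ereal (real (multiplicity (int p) a))"
  using padic_val_fraction[of a 1] by simp

lemma padic_val_of_int_ge_0: "v (of_int a) \<ge> 0"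
  by (cases "a = 0") (auto simp: padic_val_of_int)

lemma padic_val_of_int_ge_1_iff: "v (of_int a) \<ge> 1 \<longleftrightarrow> int p dvd a"
proof (cases "a = 0")
  case False
  have "int p dvd a \<longleftrightarrow> multiplicity (int p) a \<ge> 1"
    using power_dvd_iff_le_multiplicity[of a "int p" 1] False prime_p prime_gt_1_nat[OF prime_p]
    by simp
  thus ?thesis using False by (simp add: padic_val_of_int one_ereal_def)
qed simp

lemma padic_val_of_nat_ge_1_iff: "v (of_nat n) \<ge> 1 \<longleftrightarrow> p dvd n"
  using padic_val_of_int_ge_1_iff[of "int n"] by simp

lemma padic_val_one [simp]: "v 1 = 0"
  using padic_val_of_int[of 1] by (simp add: zero_ereal_def)

lemma padic_val_mult: "v (x * y) = v x + v y"
proof (cases "x = 0 \<or> y = 0")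
  case True
  thus ?thesis by (auto simp: padic_val_def)
next
  case False
  then obtain a n b m where *: "a \<noteq> 0" "n \<noteq> 0" "x = of_int a / of_int n"
      "b \<noteq> 0" "m \<noteq> 0" "y = of_int b / of_int m"
    by (metis rat_fractionE)
  have "x * y = of_int (a * b) / of_int (n * m)" using * by simp
  hence "v (x * y) = ereal (real (multiplicity (int p) (a * b))
      - real (multiplicity (int p) (n * m)))"
    using * padic_val_fraction[of "a * b" "n * m"] by simp
  moreover have "multiplicity (int p) (a * b) = multiplicity (int p) a + multiplicity (int p) b"
      "multiplicity (int p) (n * m) = multiplicity (int p) n + multiplicity (int p) m"
    using * prime_elem_multiplicity_mult_distrib[OF prime_elem_int_p] by auto
  ultimately show ?thesis using * padic_val_fraction[of a n] padic_val_fraction[of b m] by simp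
qed

lemma padic_val_uminus [simp]: "v (- x) = v x"
proof -
  have "v (-1) = 0"
    using padic_val_of_int[of "-1"] by (simp add: zero_ereal_def)
  thus ?thesis using padic_val_mult[of "-1" x] by simp
qed

lemma padic_val_diff_commute: "v (x - y) = v (y - x)"
  using padic_val_uminus[of "x - y"] by simp

lemma padic_val_power: "v x = ereal t \<Longrightarrow> v (x ^ n) = ereal (real n * t)"
  by (induction n) (auto simp: padic_val_mult algebra_simps zero_ereal_def)

lemma padic_val_add_ge_min: "v (x + y) \<ge> min (v x) (v y)"
proof (cases "x = 0 \<or> y = 0 \<or> x + y = 0")
  case False
  then obtain a n b m where *: "a \<noteq> 0" "n \<noteq> 0" "x = of_int a / of_int n"
      "b \<noteq> 0" "m \<noteq> 0" "y = of_int b / of_int m"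
    by (metis rat_fractionE)
  let ?\<mu> = "multiplicity (int p)"
  have x: "x = of_int (a * m) / of_int (n * m)" and y: "y = of_int (b * n) / of_int (n * m)"
    and xy: "x + y = of_int (a * m + b * n) / of_int (n * m)"
    using * by (simp_all add: field_simps)
  have nz: "a * m + b * n \<noteq> 0"
  proof
    assume "a * m + b * n = 0"
    with xy have "x + y = 0" by simp
    with False show False by simp
  qed
  let ?k = "min (?\<mu> (a * m)) (?\<mu> (b * n))"
  have "int p ^ ?k dvd a * m" "int p ^ ?k dvd b * n"
    by (auto intro: multiplicity_dvd')
  hence "int p ^ ?k dvd a * m + b * n" by (rule dvd_add)
  hence "?k \<le> ?\<mu> (a * m + b * n)"
    using nz prime_p by (auto intro!: multiplicity_geI dest: not_prime_unit)
  moreover have "v x = ereal (real (?\<mu> (a * m)) - real (?\<mu> (n * m)))"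
      "v y = ereal (real (?\<mu> (b * n)) - real (?\<mu> (n * m)))"
      "v (x + y) = ereal (real (?\<mu> (a * m + b * n)) - real (?\<mu> (n * m)))"
    unfolding xy unfolding x y using * nz by (intro padic_val_fraction; simp)+
  ultimately show ?thesis by (auto simp: min_def split: if_splits)
qed (auto simp: min_def)

lemma padic_val_add_ge: "v x \<ge> t \<Longrightarrow> v y \<ge> t \<Longrightarrow> v (x + y) \<ge> t"
  using padic_val_add_ge_min[of x y] by (meson min.boundedI order.trans)

lemma padic_val_diff_ge: "v x \<ge> t \<Longrightarrow> v y \<ge> t \<Longrightarrow> v (x - y) \<ge> t"
  using padic_val_add_ge[of t x "- y"] by simp

lemma padic_val_add_gt: "v x > t \<Longrightarrow> v y > t \<Longrightarrow> v (x + y) > t"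
  using padic_val_add_ge_min[of x y] by (meson min_less_iff_conj less_le_trans)

lemma padic_val_add_eq:
  assumes "v x = t" "v y > t"
  shows "v (x + y) = t"
proof (rule antisym)
  show "v (x + y) \<ge> t" using assms by (intro padic_val_add_ge) auto
  show "v (x + y) \<le> t"
  proof (rule ccontr)
    assume "\<not> ?thesis"
    hence "t < v (x + y)" "t < v (- y)" using assms by auto
    from padic_val_add_gt[OF this] assms show False by simp
  qed
qed

lemma padic_val_sum_ge: "(\<And>i. i \<in> A \<Longrightarrow> v (g i) \<ge> t) \<Longrightarrow> v (\<Sum>i\<in>A. g i) \<ge> t"
  by (induction A rule: infinite_finite_induct) (auto intro: padic_val_add_ge)

lemma padic_val_sum_gt:
  "t < \<infinity> \<Longrightarrow> (\<And>i. i \<in> A \<Longrightarrow> v (g i) > t) \<Longrightarrow> v (\<Sum>i\<in>A. g i) > t"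
  by (induction A rule: infinite_finite_induct) (auto intro: padic_val_add_gt)

text \<open>A strictly dominating term cannot be cancelled in an ultrametric; this evaluates
  coefficients at corners of a polygon.\<close>

lemma padic_val_sum_eq:
  assumes "finite A" "j \<in> A" "v (g j) = ereal t" "\<And>i. i \<in> A \<Longrightarrow> i \<noteq> j \<Longrightarrow> v (g i) > ereal t"
  shows "v (\<Sum>i\<in>A. g i) = ereal t"
proof -
  have "v (g j + (\<Sum>i\<in>A - {j}. g i)) = ereal t"
    using assms by (intro padic_val_add_eq padic_val_sum_gt) auto
  thus ?thesis using assms by (simp add: sum.remove)
qed

lemma padic_val_mult_ge:
  "v x \<ge> ereal s \<Longrightarrow> v y \<ge> ereal t \<Longrightarrow> v (x * y) \<ge> ereal (s + t)"
  using add_mono[of "ereal s" "v x" "ereal t" "v y"] by (simp add: padic_val_mult)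

lemma padic_val_mult_gt:
  assumes "v x > ereal s" "v y \<ge> ereal t"
  shows "v (x * y) > ereal (s + t)"
  using assms by (cases "v x"; cases "v y") (auto simp: padic_val_mult)

lemma padic_val_gt_imp_ge:
  assumes "v x > ereal (of_int k)"
  shows "v x \<ge> ereal (of_int (k + 1))"
proof (cases "x = 0")
  case False
  then obtain l :: int where "v x = ereal (of_int l)" by (rule padic_val_eq_int)
  with assms show ?thesis by simp
qed simp

lemma padic_val_gt_0_imp_ge_1: "v x > 0 \<Longrightarrow> v x \<ge> 1"
  using padic_val_gt_imp_ge[of 0 x] by (simp add: one_ereal_def zero_ereal_def)

lemma padic_val_mult_ge_0: "v x \<ge> 0 \<Longrightarrow> v y \<ge> 0 \<Longrightarrow> v (x * y) \<ge> 0"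
  by (simp add: padic_val_mult)

lemma padic_val_mult_ge_1: "v x \<ge> 1 \<Longrightarrow> v y \<ge> 0 \<Longrightarrow> v (x * y) \<ge> 1"
  using add_mono[of 1 "v x" 0 "v y"] by (simp add: padic_val_mult)

lemma padic_val_power_ge_0: "v x \<ge> 0 \<Longrightarrow> v (x ^ n) \<ge> 0"
  by (induction n) (auto intro: padic_val_mult_ge_0)

lemma padic_val_poly_ge_0:
  assumes "\<And>i. v (coeff f i) \<ge> 0" "v x \<ge> 0"
  shows "v (poly f x) \<ge> 0"
  unfolding poly_altdef
  using assms by (intro padic_val_sum_ge padic_val_mult_ge_0 padic_val_power_ge_0)

subsection \<open>Newton polygons under composition\<close>

text \<open>\<open>newton_init s k i f\<close>: giving \<open>x\<close> the weight \<open>s\<close>, the monomials of \<open>f\<close> of least weight have weight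
  \<open>k\<close>, and \<open>i\<close> is the smallest exponent among them. Equivalently, the supporting line of slope \<open>- s\<close>
  touches the Newton polygon of \<open>f\<close> at a segment with left endpoint at abscissa \<open>i\<close>.\<close>

definition newton_init :: "real \<Rightarrow> real \<Rightarrow> nat \<Rightarrow> rat poly \<Rightarrow> bool" where
  "newton_init s k i f \<longleftrightarrow>
     (\<forall>j. v (coeff f j) \<ge> ereal (k - s * real j)) \<and>
     v (coeff f i) = ereal (k - s * real i) \<and>
     (\<forall>j<i. v (coeff f j) > ereal (k - s * real j))"

lemma newton_initI:
  assumes "\<And>j. v (coeff f j) \<ge> ereal (k - s * real j)"
    "v (coeff f i) = ereal (k - s * real i)"
    "\<And>j. j < i \<Longrightarrow> v (coeff f j) > ereal (k - s * real j)"
  shows "newton_init s k i f"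
  using assms by (auto simp: newton_init_def)

lemma newton_initD:
  assumes "newton_init s k i f"
  shows "v (coeff f j) \<ge> ereal (k - s * real j)"
    "v (coeff f i) = ereal (k - s * real i)"
    "j < i \<Longrightarrow> v (coeff f j) > ereal (k - s * real j)"
  using assms by (auto simp: newton_init_def)

text \<open>\<open>k\<close> is the least weight, so \<open>f\<close> and \<open>s\<close> determine
  it, and then also the first exponent attaining it. Later contradictions compute this exponent for
  one composite in two ways.\<close>

lemma newton_init_index_unique:
  assumes "newton_init s k i f" "newton_init s l j f"
  shows "i = j"
proof -
  have "k = l"
    using newton_initD(1)[OF assms(1), of j] newton_initD(2)[OF assms(1)]
      newton_initD(1)[OF assms(2), of i] newton_initD(2)[OF assms(2)] by simp
  moreover have "\<not> i < j"
    using newton_initD(2)[OF assms(1)] newton_initD(3)[OF assms(2), of i] \<open>k = l\<close> by auto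
  moreover have "\<not> j < i"
    using newton_initD(2)[OF assms(2)] newton_initD(3)[OF assms(1), of j] \<open>k = l\<close> by auto
  ultimately show ?thesis by simp
qed

text \<open>As in Gauss's lemma, weights add, and at exponent \<open>i + j\<close> every pair other
  than \<open>(i, j)\<close> has a member below its bound, so it is strictly heavier.\<close>

lemma newton_init_mult:
  assumes f: "newton_init s k i f" and g: "newton_init s l j g"
  shows "newton_init s (k + l) (i + j) (f * g)"
proof (rule newton_initI)
  have wt: "k + l - s * real n = (k - s * real m) + (l - s * real (n - m))" if "m \<le> n" for n m
    using that by (simp add: algebra_simps of_nat_diff)
  have gt: "v (coeff f m * coeff g (n - m)) > ereal (k + l - s * real n)"
    if "m \<le> n" "m < i \<or> n - m < j" for m n
  proof (cases "m < i")
    case True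
    thus ?thesis unfolding wt[OF that(1)]
      using newton_initD(3)[OF f] newton_initD(1)[OF g] by (intro padic_val_mult_gt) auto
  next
    case False
    hence "v (coeff g (n - m) * coeff f m) > ereal (l - s * real (n - m) + (k - s * real m))"
      using newton_initD(3)[OF g] newton_initD(1)[OF f] that(2) by (intro padic_val_mult_gt) auto
    thus ?thesis unfolding wt[OF that(1)] by (simp add: mult.commute add.commute)
  qed
  show "v (coeff (f * g) n) \<ge> ereal (k + l - s * real n)" for n
    unfolding coeff_mult
  proof (rule padic_val_sum_ge)
    fix m assume "m \<in> {..n}"
    hence "m \<le> n" by simp
    show "v (coeff f m * coeff g (n - m)) \<ge> ereal (k + l - s * real n)"
      unfolding wt[OF \<open>m \<le> n\<close>]
      using newton_initD(1)[OF f] newton_initD(1)[OF g] by (intro padic_val_mult_ge) auto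
  qed
  show "v (coeff (f * g) n) > ereal (k + l - s * real n)" if "n < i + j" for n
    unfolding coeff_mult
  proof (rule padic_val_sum_gt)
    fix m assume "m \<in> {..n}"
    thus "v (coeff f m * coeff g (n - m)) > ereal (k + l - s * real n)"
      using that by (intro gt) auto
  qed simp
  show "v (coeff (f * g) (i + j)) = ereal (k + l - s * real (i + j))"
    unfolding coeff_mult
  proof (rule padic_val_sum_eq[where j = i])
    show "v (coeff f i * coeff g (i + j - i)) = ereal (k + l - s * real (i + j))"
      using newton_initD(2)[OF f] newton_initD(2)[OF g]
      by (simp add: padic_val_mult algebra_simps)
    fix m assume "m \<in> {..i + j}" "m \<noteq> i"
    thus "v (coeff f m * coeff g (i + j - m)) > ereal (k + l - s * real (i + j))"
      by (intro gt) auto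
  qed auto
qed

lemma newton_init_power:
  assumes "newton_init s k i f"
  shows "newton_init s (real n * k) (n * i) (f ^ n)"
proof (induction n)
  case 0
  show ?case by (rule newton_initI) (auto simp: coeff_pCons zero_ereal_def split: nat.split)
next
  case (Suc n)
  show ?case using newton_init_mult[OF assms Suc] by (simp add: algebra_simps)
qed

lemma coeff_pcompose_sum:
  fixes f g :: "'a :: comm_ring_1 poly"
  shows "coeff (pcompose f g) n = (\<Sum>m\<le>degree f. coeff f m * coeff (g ^ m) n)"
  by (simp add: pcompose_altdef poly_altdef coeff_sum degree_map_poly coeff_map_poly)

text \<open>Substituting \<open>g\<close> of least weight \<open>t\<close> for a variable of weight
  \<open>t\<close> preserves weights, and \<open>g ^ m\<close> starts at \<open>m * D\<close>. At
  \<open>D * i\<close> only \<open>m = i\<close> attains weight \<open>k\<close>: smaller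
  \<open>m\<close> are heavier in \<open>f\<close>, larger ones start later if \<open>D > 0\<close>
  or do not occur if \<open>degree f \<le> i\<close>.\<close>

lemma newton_init_pcompose:
  assumes f: "newton_init t k i f" and g: "newton_init s t D g" and D: "D > 0 \<or> degree f \<le> i"
  shows "newton_init s k (D * i) (pcompose f g)"
proof (rule newton_initI)
  note gm = newton_init_power[OF g]
  have wt: "k - s * real n = (k - t * real m) + (real m * t - s * real n)" for n m :: nat
    by simp
  have gt: "v (coeff f m * coeff (g ^ m) n) > ereal (k - s * real n)"
    if "m < i \<or> n < m * D" for m n
  proof (cases "m < i")
    case True
    thus ?thesis unfolding wt[of n m]
      using newton_initD(3)[OF f] newton_initD(1)[OF gm] by (intro padic_val_mult_gt) auto
  next
    case False
    hence "v (coeff (g ^ m) n * coeff f m) > ereal ((real m * t - s * real n) + (k - t * real m))"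
      using newton_initD(3)[OF gm] newton_initD(1)[OF f] that by (intro padic_val_mult_gt) auto
    thus ?thesis unfolding wt[of n m] by (simp add: mult.commute add.commute)
  qed
  show "v (coeff (pcompose f g) n) \<ge> ereal (k - s * real n)" for n
    unfolding coeff_pcompose_sum
  proof (rule padic_val_sum_ge)
    fix m
    show "v (coeff f m * coeff (g ^ m) n) \<ge> ereal (k - s * real n)"
      unfolding wt[of n m]
      using newton_initD(1)[OF f] newton_initD(1)[OF gm] by (intro padic_val_mult_ge) auto
  qed
  show "v (coeff (pcompose f g) n) > ereal (k - s * real n)" if "n < D * i" for n
    unfolding coeff_pcompose_sum
  proof (rule padic_val_sum_gt)
    fix m
    have "n < m * D" if "\<not> m < i"
    proof -
      have "D * i \<le> D * m" using that by simp
      with \<open>n < D * i\<close> show ?thesis by (simp only: mult.commute[of m])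
    qed
    thus "v (coeff f m * coeff (g ^ m) n) > ereal (k - s * real n)"
      by (intro gt) auto
  qed simp
  show "v (coeff (pcompose f g) (D * i)) = ereal (k - s * real (D * i))"
    unfolding coeff_pcompose_sum
  proof (rule padic_val_sum_eq[where j = i])
    have "coeff f i \<noteq> 0" using newton_initD(2)[OF f] by auto
    thus "i \<in> {..degree f}" by (simp add: le_degree)
    show "v (coeff f i * coeff (g ^ i) (D * i)) = ereal (k - s * real (D * i))"
      using newton_initD(2)[OF f] newton_initD(2)[OF gm[of i]]
      by (simp add: padic_val_mult algebra_simps)
    fix m assume "m \<in> {..degree f}" "m \<noteq> i"
    hence "m < i \<or> D * i < m * D" using D by auto
    thus "v (coeff f m * coeff (g ^ m) (D * i)) > ereal (k - s * real (D * i))"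
      by (rule gt)
  qed auto
qed

text \<open>All points lie on or above the line of slope \<open>- l\<close> through the right
  endpoint, so the line of slope \<open>- t\<close> through it meets no other point.\<close>

lemma newton_init_degree:
  assumes lead: "v (lead_coeff f) = 0"
    and slope: "\<And>j. j < degree f \<Longrightarrow> v (coeff f j) \<ge> ereal (l * real (degree f - j))"
    and "t < l"
  shows "newton_init t (t * real (degree f)) (degree f) f"
proof (rule newton_initI)
  show gt: "v (coeff f j) > ereal (t * real (degree f) - t * real j)" if "j < degree f" for j
  proof -
    have "t * real (degree f) - t * real j = t * real (degree f - j)"
      using that by (simp add: algebra_simps of_nat_diff)
    also have "\<dots> < l * real (degree f - j)" using that \<open>t < l\<close> by simp
    finally show ?thesis using slope[OF that] by (meson ereal_less(1) less_ereal.simps(1) less_le_trans)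
  qed
  show "v (coeff f (degree f)) = ereal (t * real (degree f) - t * real (degree f))"
    using lead by (simp add: zero_ereal_def)
  show "v (coeff f j) \<ge> ereal (t * real (degree f) - t * real j)" for j
  proof (cases j "degree f" rule: linorder_cases)
    case less
    thus ?thesis using gt by (simp add: less_imp_le)
  next
    case equal
    thus ?thesis using lead by (simp add: zero_ereal_def)
  next
    case greater
    thus ?thesis by (simp add: coeff_eq_0)
  qed
qed

text \<open>Extracts the last segment of the Newton polygon, with slope \<open>- l\<close> and left
  end \<open>i\<close>; the point at \<open>i0\<close> forces \<open>l < l0\<close>.\<close>

lemma newton_last_slope:
  assumes lead: "v (lead_coeff f) = 0"
    and steep: "i0 < degree f" "v (coeff f i0) < ereal (l0 * real (degree f - i0))"
  obtains l i where "l < l0" "i < degree f" "newton_init l (l * real (degree f)) i f"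
    "\<And>j. j < degree f \<Longrightarrow> v (coeff f j) \<ge> ereal (l * real (degree f - j))"
proof -
  define d where "d = degree f"
  define A where "A = {j. j < d \<and> coeff f j \<noteq> 0}"
  \<comment> \<open>Minus the slope of the chord from the point at \<open>j\<close> to the right
    endpoint. Only nonzero coefficients enter \<open>A\<close>, since \<open>real_of_ereal\<close>
    sends an infinite valuation to \<open>0\<close>.\<close>
  define \<sigma> where "\<sigma> j = real_of_ereal (v (coeff f j)) / real (d - j)" for j
  define l where "l = Min (\<sigma> ` A)"
  have fin: "finite A" by (simp add: A_def)
  have \<sigma>: "v (coeff f j) = ereal (\<sigma> j * real (d - j))" if "j \<in> A" for j
  proof -
    from that have "coeff f j \<noteq> 0" by (simp add: A_def)
    then obtain k :: int where "v (coeff f j) = ereal (of_int k)" by (rule padic_val_eq_int)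
    thus ?thesis using that by (simp add: \<sigma>_def A_def)
  qed
  have i0: "i0 \<in> A" using steep by (auto simp: A_def d_def)
  have l_le: "l \<le> \<sigma> j" if "j \<in> A" for j
    using that fin by (simp add: l_def)
  have "l \<in> \<sigma> ` A" unfolding l_def using fin i0 by (intro Min_in) auto
  then obtain i1 where i1: "i1 \<in> A" "\<sigma> i1 = l" by auto
  define i where "i = (LEAST j. j \<in> A \<and> \<sigma> j = l)"
  have i: "i \<in> A" "\<sigma> i = l"
    using LeastI[of "\<lambda>j. j \<in> A \<and> \<sigma> j = l" i1] i1 by (auto simp: i_def)
  have least: "\<sigma> j \<noteq> l" if "j \<in> A" "j < i" for j
    using not_less_Least[of j "\<lambda>j. j \<in> A \<and> \<sigma> j = l"] that by (auto simp: i_def)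
  have id: "i < d" using i by (simp add: A_def)
  have ge: "v (coeff f j) \<ge> ereal (l * real (d - j))" if "j < d" for j
  proof (cases "coeff f j = 0")
    case False
    hence "j \<in> A" using that by (simp add: A_def)
    from \<sigma>[OF this] l_le[OF this] show ?thesis by (simp add: mult_right_mono)
  qed simp
  have diff: "l * real d - l * real j = l * real (d - j)" if "j < d" for j
    using that by (simp add: algebra_simps of_nat_diff)
  show ?thesis
  proof (rule that[of l i])
    have "\<sigma> i0 * real (d - i0) < l0 * real (d - i0)"
      using steep \<sigma>[OF i0] by (simp add: d_def)
    hence "\<sigma> i0 < l0" using steep by (simp add: d_def)
    with l_le[OF i0] show "l < l0" by simp
    show "i < degree f" using id by (simp add: d_def)
    show "v (coeff f j) \<ge> ereal (l * real (degree f - j))" if "j < degree f" for j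
      using ge that by (simp add: d_def)
    show "newton_init l (l * real (degree f)) i f"
      unfolding d_def[symmetric]
    proof (rule newton_initI)
      show "v (coeff f j) \<ge> ereal (l * real d - l * real j)" for j
      proof (cases j d rule: linorder_cases)
        case less
        thus ?thesis using ge diff by simp
      next
        case equal
        thus ?thesis using lead by (simp add: d_def zero_ereal_def)
      next
        case greater
        thus ?thesis by (simp add: d_def coeff_eq_0)
      qed
      show "v (coeff f i) = ereal (l * real d - l * real i)"
        using \<sigma>[OF i(1)] i(2) diff[OF id] by simp
      show "v (coeff f j) > ereal (l * real d - l * real j)" if "j < i" for j
      proof (cases "coeff f j = 0")
        case False
        hence j: "j \<in> A" using that id by (simp add: A_def)
        have "l < \<sigma> j" using l_le[OF j] least[OF j that] by simp
        thus ?thesis using \<sigma>[OF j] diff[of j] that id by simp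
      qed simp
    qed
  qed
qed

lemma padic_integral_pcompose:
  assumes "\<And>j. v (coeff f j) \<ge> 0" "\<And>j. v (coeff g j) \<ge> 0"
  shows "v (coeff (pcompose f g) j) \<ge> 0"
  using coeff_pcompose_semiring_closed[of "{x. v x \<ge> 0}" f g j] assms
  by (auto intro: padic_val_add_ge padic_val_mult_ge_0)

lemma padic_integral_linear:
  "v c \<ge> 0 \<Longrightarrow> v (coeff [:c, 1:] j) \<ge> 0"
  by (auto simp: coeff_pCons split: nat.split)

text \<open>At slope zero the index is the order of vanishing at \<open>0\<close> of the reduction
  modulo \<open>p\<close>, which is nonzero because the leading coefficient is a unit.\<close>

lemma newton_init_integral:
  assumes "\<And>j. v (coeff f j) \<ge> 0" "v (lead_coeff f) = 0"
  obtains i where "i \<le> degree f" "newton_init 0 0 i f"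
proof
  define i where "i = (LEAST j. v (coeff f j) = 0)"
  show "i \<le> degree f" unfolding i_def by (rule Least_le) (use assms in simp)
  show "newton_init 0 0 i f"
  proof (rule newton_initI)
    show "v (coeff f i) = ereal (0 - 0 * real i)"
      using LeastI[of "\<lambda>j. v (coeff f j) = 0", OF assms(2)] by (simp add: i_def zero_ereal_def)
    show "v (coeff f j) > ereal (0 - 0 * real j)" if "j < i" for j
      using not_less_Least[of j "\<lambda>j. v (coeff f j) = 0"] that assms(1)[of j]
      by (auto simp: i_def zero_ereal_def[symmetric] less_le)
  qed (use assms in \<open>simp add: zero_ereal_def\<close>)
qed

text \<open>Over the residue field: if \<open>G(H(x))\<close> is a monomial and \<open>H(0) = 0\<close>, then both \<open>G\<close> and \<open>H\<close> are monomials,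
  because the orders of vanishing at \<open>0\<close> multiply and are bounded by the degrees.\<close>

lemma newton_init_pcompose_cancel:
  assumes G: "\<And>j. v (coeff G j) \<ge> 0" "v (lead_coeff G) = 0"
    and H: "\<And>j. v (coeff H j) \<ge> 0" "v (lead_coeff H) = 0" "coeff H 0 = 0"
    and deg: "degree G > 0"
    and comp: "newton_init 0 0 (degree (pcompose G H)) (pcompose G H)"
  shows "newton_init 0 0 (degree G) G" "newton_init 0 0 (degree H) H"
proof -
  obtain i where i: "i \<le> degree G" "newton_init 0 0 i G" using newton_init_integral[OF G] .
  obtain j where j: "j \<le> degree H" "newton_init 0 0 j H" using newton_init_integral[OF H(1,2)] .
  have j0: "j > 0"
    using newton_initD(2)[OF j(2)] H(3) by (cases j) auto
  have "newton_init 0 0 (j * i) (pcompose G H)"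
    by (rule newton_init_pcompose[OF i(2) j(2)]) (use j0 in simp)
  from newton_init_index_unique[OF this comp] have eq: "j * i = degree G * degree H"
    by (simp add: degree_pcompose)
  have "i = degree G"
  proof (rule ccontr)
    assume "i \<noteq> degree G"
    hence "i < degree G" using i by simp
    hence "j * i < degree H * degree G" using j j0
      by (metis le_less_trans mult_le_mono1 nat_mult_less_cancel_disj neq0_conv not_less)
    thus False using eq by (simp add: mult.commute)
  qed
  moreover from this eq deg have "j = degree H" by simp
  ultimately show "newton_init 0 0 (degree G) G" "newton_init 0 0 (degree H) H"
    using i j by auto
qed

subsection \<open>Pure polynomials and iterates\<close>

text \<open>Clears denominators and admits index \<open>0\<close>, where the bound is just
  \<open>r\<close>.\<close>

lemma pure_poly_iff:
  assumes "degree g > 0"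
  shows "pure_poly p r g \<longleftrightarrow> v (lead_coeff g) = 0 \<and> v (coeff g 0) = ereal (real r) \<and>
    (\<forall>i<degree g. v (coeff g i) \<ge> ereal (real r / real (degree g) * real (degree g - i)))"
proof -
  have div: "v x / ereal k \<ge> ereal q \<longleftrightarrow> v x \<ge> ereal (q * k)" if "k > 0" for x k q
    using that by (cases "v x") (auto simp: field_simps)
  have "(\<forall>i\<in>{1..degree g - 1}.
        v (coeff g i) / ereal (real (degree g - i)) \<ge> ereal (real r / real (degree g)))
      \<longleftrightarrow> (\<forall>i\<in>{1..degree g - 1}.
        v (coeff g i) \<ge> ereal (real r / real (degree g) * real (degree g - i)))"
    using assms by (intro ball_cong refl div) auto
  also have "\<dots> \<longleftrightarrow> (\<forall>i<degree g. v (coeff g i) \<ge> ereal (real r / real (degree g) * real (degree g - i)))"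
    if "v (coeff g 0) = ereal (real r)"
  proof (intro iffI allI impI ballI)
    fix i assume *: "\<forall>i\<in>{1..degree g - 1}.
        v (coeff g i) \<ge> ereal (real r / real (degree g) * real (degree g - i))" "i < degree g"
    show "v (coeff g i) \<ge> ereal (real r / real (degree g) * real (degree g - i))"
    proof (cases "i = 0")
      case False
      with * have "i \<in> {1..degree g - 1}" by auto
      with * show ?thesis by blast
    qed (use that assms in simp)
  next
    fix i assume *: "\<forall>i<degree g. v (coeff g i) \<ge> ereal (real r / real (degree g) * real (degree g - i))"
       "i \<in> {1..degree g - 1}"
    have "i < degree g" using *(2) assms by auto
    thus "v (coeff g i) \<ge> ereal (real r / real (degree g) * real (degree g - i))"
      using * by blast
  qed
  ultimately show ?thesis unfolding pure_poly_def by blast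
qed

section \<open>Iterates: degrees, leading coefficients, integrality\<close>

lemma poly_iterate_0 [simp]: "poly_iterate f 0 = [:0, 1:]"
  by (simp add: poly_iterate_def)

lemma poly_iterate_Suc: "poly_iterate f (Suc n) = pcompose f (poly_iterate f n)"
  by (simp add: poly_iterate_def)

lemma poly_iterate_Suc_right:
  fixes f :: "'a :: comm_semiring_1 poly"
  shows "poly_iterate f (Suc n) = pcompose (poly_iterate f n) f"
proof (induction n)
  case 0
  show ?case by (simp add: poly_iterate_Suc pcompose_pCons)
next
  case (Suc n)
  thus ?case by (metis poly_iterate_Suc pcompose_assoc)
qed

lemma degree_poly_iterate:
  "degree (poly_iterate (f :: rat poly) n) = degree f ^ n"
  by (induction n) (auto simp: poly_iterate_Suc degree_pcompose)

lemma coeff_0_poly_iterate: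
  fixes f :: "'a :: comm_semiring_1 poly"
  shows "coeff (poly_iterate f (Suc n)) 0 = poly f (coeff (poly_iterate f n) 0)"
  by (simp add: poly_iterate_Suc)

lemma padic_val_lead_coeff_pcompose:
  assumes "degree g > 0" "v (lead_coeff f) = 0" "v (lead_coeff g) = 0"
  shows "v (lead_coeff (pcompose f g)) = 0"
  using assms padic_val_power[of "lead_coeff g" 0 "degree f"]
  by (simp add: lead_coeff_comp padic_val_mult zero_ereal_def)

text \<open>The exponent is \<open>1 + d + ... + d^n\<close>; its positivity lets the unit property
  pass back from the iterate to \<open>f\<close>.\<close>

lemma lead_coeff_poly_iterate:
  fixes f :: "rat poly"
  assumes "degree f > 0"
  shows "\<exists>k>0. lead_coeff (poly_iterate f (Suc n)) = lead_coeff f ^ k"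
proof (induction n)
  case 0
  show ?case by (rule exI[of _ 1]) (simp add: poly_iterate_Suc)
next
  case (Suc n)
  then obtain k where k: "k > 0" "lead_coeff (poly_iterate f (Suc n)) = lead_coeff f ^ k" by blast
  have "lead_coeff (poly_iterate f (Suc (Suc n)))
      = lead_coeff f * lead_coeff (poly_iterate f (Suc n)) ^ degree f"
    unfolding poly_iterate_Suc[of f "Suc n"]
    using assms by (subst lead_coeff_comp) (simp_all add: degree_poly_iterate)
  also have "\<dots> = lead_coeff f ^ Suc (k * degree f)"
    by (simp add: k power_mult)
  finally show ?case by blast
qed

lemma padic_val_lead_coeff_poly_iterate:
  assumes "degree f > 0"
  shows "v (lead_coeff (poly_iterate f (Suc n))) = 0 \<longleftrightarrow> v (lead_coeff f) = 0"
proof -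
  obtain k where k: "k > 0" "lead_coeff (poly_iterate f (Suc n)) = lead_coeff f ^ k"
    using lead_coeff_poly_iterate[OF assms] by blast
  have "lead_coeff f \<noteq> 0" using assms by auto
  then obtain t :: int where t: "v (lead_coeff f) = ereal (of_int t)" by (rule padic_val_eq_int)
  show ?thesis unfolding k(2) padic_val_power[OF t] t using k(1) by (simp add: zero_ereal_def)
qed

lemma padic_integral_poly_iterate:
  assumes "\<And>j. v (coeff f j) \<ge> 0"
  shows "v (coeff (poly_iterate f n) j) \<ge> 0"
proof (induction n arbitrary: j)
  case 0
  show ?case using padic_integral_linear[of 0 j] by simp
next
  case (Suc n)
  show ?case unfolding poly_iterate_Suc using assms Suc by (rule padic_integral_pcompose)
qed

lemma pure_poly_newton_init:
  assumes "degree g > 0" "pure_poly p r g" "t < real r / real (degree g)"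
  shows "newton_init t (t * real (degree g)) (degree g) g"
  using assms pure_poly_iff[OF assms(1)] by (intro newton_init_degree) auto

text \<open>Purity says that the polygon is the single segment from \<open>(0, r)\<close> to
  \<open>(degree g, 0)\<close>, whose left endpoint is at \<open>0\<close>.\<close>

lemma pure_poly_iff_newton_init:
  assumes "degree g > 0"
  shows "pure_poly p r g \<longleftrightarrow>
    v (lead_coeff g) = 0 \<and> newton_init (real r / real (degree g)) (real r) 0 g"
proof -
  define d where "d = degree g"
  define s where "s = real r / real d"
  have sd: "s * real d = real r" using assms by (simp add: s_def d_def)
  have diff: "s * real (d - i) = real r - s * real i" if "i < d" for i
    using that sd by (simp add: algebra_simps of_nat_diff)
  have "(\<forall>i. v (coeff g i) \<ge> ereal (real r - s * real i))
      \<longleftrightarrow> (\<forall>i<d. v (coeff g i) \<ge> ereal (s * real (d - i)))" if lead: "v (lead_coeff g) = 0"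
  proof (intro iffI allI impI)
    fix i assume *: "\<forall>i<d. v (coeff g i) \<ge> ereal (s * real (d - i))"
    show "v (coeff g i) \<ge> ereal (real r - s * real i)"
    proof (cases i d rule: linorder_cases)
      case less
      thus ?thesis using * diff by simp
    next
      case equal
      thus ?thesis using lead sd by (simp add: d_def zero_ereal_def)
    next
      case greater
      thus ?thesis by (simp add: d_def coeff_eq_0)
    qed
  qed (metis diff)
  thus ?thesis
    unfolding pure_poly_iff[OF assms] newton_init_def d_def[symmetric] s_def[symmetric] by auto
qed

section \<open>Purity under composition with monomials modulo \<open>p\<close>\<close>

lemma newton_init_fractional_weight:
  assumes "v (lead_coeff h) = 0" "degree h > 0" "\<And>j. j < degree h \<Longrightarrow> v (coeff h j) \<ge> 1" "l < 1"
  shows "newton_init (l / real (degree h)) l (degree h) h"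
proof -
  have "newton_init (l / real (degree h)) (l / real (degree h) * real (degree h)) (degree h) h"
  proof (rule newton_init_degree)
    fix j assume j: "j < degree h"
    \<comment> \<open>Valuations \<open>\<ge> 1\<close> put the points on or above the segment from
      \<open>(0, 1)\<close> to \<open>(degree h, 0)\<close>, so a flatter line touches only at the
      leading term.\<close>
    have "1 / real (degree h) * real (degree h - j) \<le> 1" using j by (simp add: field_simps)
    hence "ereal (1 / real (degree h) * real (degree h - j)) \<le> 1" by (simp add: one_ereal_def)
    with assms(3)[OF j] show "v (coeff h j) \<ge> ereal (1 / real (degree h) * real (degree h - j))"
      by (rule order.trans[rotated])
  qed (use assms in \<open>auto simp: divide_strict_right_mono\<close>)
  thus ?thesis using assms(2) by simp
qed

text \<open>As \<open>r / degree F < 1\<close>, weight \<open>r / degree F / degree h\<close> on the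
  variable gives \<open>h\<close> least weight \<open>r / degree F\<close>. The left endpoint
  \<open>0\<close> of \<open>F\<close> is multiplied by \<open>degree h\<close> and stays
  \<open>0\<close>.\<close>

lemma pure_poly_pcompose:
  assumes F: "pure_poly p r F" "degree F > r"
    and h: "v (lead_coeff h) = 0" "degree h > 0" "\<And>j. j < degree h \<Longrightarrow> v (coeff h j) \<ge> 1"
  shows "pure_poly p r (pcompose F h)"
proof -
  have d: "degree F > 0" using F by simp
  have F': "v (lead_coeff F) = 0" "newton_init (real r / real (degree F)) (real r) 0 F"
    using F(1) pure_poly_iff_newton_init[OF d] by auto
  have "newton_init (real r / real (degree F) / real (degree h)) (real r / real (degree F)) (degree h) h"
    using F(2) by (intro newton_init_fractional_weight h) simp_all
  from newton_init_pcompose[OF F'(2) this] h(2)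
  have "newton_init (real r / real (degree F) / real (degree h)) (real r) 0 (pcompose F h)" by simp
  moreover have "v (lead_coeff (pcompose F h)) = 0"
    using h(2) F'(1) h(1) by (rule padic_val_lead_coeff_pcompose)
  ultimately show ?thesis
    using d h(2) by (subst pure_poly_iff_newton_init) (auto simp: degree_pcompose)
qed

text \<open>Otherwise the last segment of \<open>F\<close> is too flat. Composing with
  \<open>h\<close> divides its slope by \<open>degree h\<close> and moves its left end to
  \<open>degree h * i\<close>, short of the right end, whereas purity lets so flat a line touch only
  at the right end.\<close>

lemma pure_poly_pcompose_outer:
  assumes F: "v (lead_coeff F) = 0" "degree F > r"
    and h: "v (lead_coeff h) = 0" "degree h > 0" "coeff h 0 = 0"
      "\<And>j. j < degree h \<Longrightarrow> v (coeff h j) \<ge> 1"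
    and pure: "pure_poly p r (pcompose F h)"
  shows "pure_poly p r F"
proof (rule ccontr)
  assume not: "\<not> pure_poly p r F"
  have d: "degree F > 0" using F by simp
  have deg: "degree (pcompose F h) > 0" using d h by (simp add: degree_pcompose)
  \<comment> \<open>Since \<open>h\<close> vanishes at \<open>0\<close>, \<open>F\<close> and the
    composite share their constant coefficient, so only a slope inequality can fail.\<close>
  have "v (coeff F 0) = ereal (real r)"
    using pure[unfolded pure_poly_iff[OF deg]] h(3) by (simp add: poly_0_coeff_0)
  with not F obtain i0 where "i0 < degree F"
      "v (coeff F i0) < ereal (real r / real (degree F) * real (degree F - i0))"
    unfolding pure_poly_iff[OF d] by (auto simp: not_le)
  from newton_last_slope[OF F(1) this] obtain l i where
    l: "l < real r / real (degree F)" "i < degree F" "newton_init l (l * real (degree F)) i F"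
    by blast
  have "real r / real (degree F) < 1" using F(2) by simp
  hence "l < 1" using l(1) by linarith
  have "newton_init (l / real (degree h)) l (degree h) h"
    using \<open>l < 1\<close> by (intro newton_init_fractional_weight h)
  from newton_init_pcompose[OF l(3) this] h(2)
  have "newton_init (l / real (degree h)) (l * real (degree F)) (degree h * i) (pcompose F h)"
    by simp
  moreover have "l / real (degree h) < real r / real (degree (pcompose F h))"
    using divide_strict_right_mono[OF l(1), of "real (degree h)"] h(2)
    by (simp add: degree_pcompose)
  from pure_poly_newton_init[OF deg pure this]
  have "newton_init (l / real (degree h)) (l / real (degree h) * real (degree (pcompose F h)))
      (degree (pcompose F h)) (pcompose F h)" .
  ultimately have "degree h * i = degree (pcompose F h)" by (rule newton_init_index_unique)
  thus False using l(2) h(2) by (simp add: degree_pcompose)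
qed

lemma pure_poly_shift:
  assumes "degree F > r" "pure_poly p r F" "v c \<ge> 1"
  shows "pure_poly p r (pcompose F [:c, 1:])"
  by (rule pure_poly_pcompose[OF assms(2,1)]) (simp_all add: assms(3))

lemma newton_init_0_coeff_ge_1:
  assumes "newton_init 0 0 i f" "j < i"
  shows "v (coeff f j) \<ge> 1"
  using newton_initD(3)[OF assms] by (intro padic_val_gt_0_imp_ge_1) (simp add: zero_ereal_def)

section \<open>Integrality of a polynomial with a pure iterate\<close>

lemma newton_init_poly_iterate:
  assumes lead: "v (lead_coeff f) = 0" and deg: "degree f > 0"
    and slope: "\<And>j. j < degree f \<Longrightarrow> v (coeff f j) \<ge> ereal (l * real (degree f - j))"
    and t: "t < l" "l \<le> 0"
  shows "newton_init t (t * real (degree f ^ n)) (degree f ^ n) (poly_iterate f n)"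
  using t(1)
proof (induction n arbitrary: t)
  case 0
  show ?case by (rule newton_initI) (auto simp: coeff_pCons zero_ereal_def split: nat.split)
next
  case (Suc n)
  \<comment> \<open>For negative \<open>t\<close>, multiplying by the degree cannot increase it, so
    the induction hypothesis covers the outer iterate at weight \<open>t * degree f\<close>.\<close>
  have "t * real (degree f) \<le> t * 1"
    using deg Suc.prems t(2) by (intro mult_left_mono_neg) auto
  hence "t * real (degree f) < l" using Suc.prems by simp
  from newton_init_pcompose[OF Suc.IH[OF this] newton_init_degree[OF lead slope Suc.prems]] deg
  show ?case by (simp add: poly_iterate_Suc_right mult.assoc)
qed

text \<open>A non-integral coefficient gives \<open>f\<close> a last segment with
  \<open>l < 0\<close>. The outer iterate sees only its leading term, so the left end survives as
  \<open>i * degree f ^ n\<close>; purity of the composite forces the right end instead.\<close>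

lemma poly_iterate_pure_imp_integral:
  assumes deg: "degree f > 1" and pure: "pure_poly p r (poly_iterate f (Suc n))"
  shows "v (lead_coeff f) = 0" "v (coeff f j) \<ge> 0"
proof -
  let ?fn = "poly_iterate f (Suc n)"
  have degn: "degree ?fn > 0" using deg by (simp add: degree_poly_iterate)
  show lead: "v (lead_coeff f) = 0"
    using pure deg padic_val_lead_coeff_poly_iterate[of f n] by (simp add: pure_poly_def)
  show "v (coeff f j) \<ge> 0"
  proof (rule ccontr)
    assume neg: "\<not> ?thesis"
    have "j < degree f"
      using neg lead coeff_eq_0[of f j] by (cases j "degree f" rule: linorder_cases) auto
    moreover have "v (coeff f j) < ereal (0 * real (degree f - j))"
      using neg by (simp add: zero_ereal_def not_le)
    ultimately obtain l i where l: "l < 0" "i < degree f"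
        "newton_init l (l * real (degree f)) i f"
        "\<And>j. j < degree f \<Longrightarrow> v (coeff f j) \<ge> ereal (l * real (degree f - j))"
      using newton_last_slope[OF lead, of j 0] by blast
    have "l * real (degree f) < l * 1"
      using l(1) deg by (intro mult_strict_left_mono_neg) auto
    hence "l * real (degree f) < l" by simp
    from newton_init_poly_iterate[OF lead _ l(4) this, of n] deg l(1)
    have "newton_init (l * real (degree f)) (l * real (degree f) * real (degree f ^ n))
        (degree f ^ n) (poly_iterate f n)" by simp
    \<comment> \<open>Here \<open>i\<close> may be \<open>0\<close>; the composition lemma applies
      because the index of the outer iterate is its own degree.\<close>
    from newton_init_pcompose[OF this l(3)]
    have "newton_init l (l * real (degree f) * real (degree f ^ n)) (i * degree f ^ n) ?fn"
      by (simp add: poly_iterate_Suc_right degree_poly_iterate)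
    moreover have "l < real r / real (degree ?fn)"
      using l(1) by (meson divide_nonneg_nonneg less_le_trans of_nat_0_le_iff)
    from pure_poly_newton_init[OF degn pure this]
    have "newton_init l (l * real (degree ?fn)) (degree ?fn) ?fn" .
    ultimately have "i * degree f ^ n = degree ?fn" by (rule newton_init_index_unique)
    thus False using l(2) deg by (simp add: degree_poly_iterate)
  qed
qed

section \<open>Shifts and binomial coefficients modulo \<open>p\<close>\<close>

lemma coeff_shift_cong:
  assumes mid: "\<And>m. 0 < m \<Longrightarrow> m < degree f \<Longrightarrow> v (coeff f m) \<ge> 1"
    and x: "v x \<ge> 0" and j: "0 < j" "j < degree f"
  shows "v (coeff (pcompose f [:x, 1:]) j
    - lead_coeff f * (of_nat (degree f choose j) * x ^ (degree f - j))) \<ge> 1"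
proof -
  have lin: "v (coeff ([:x, 1:] ^ m) j) \<ge> 0" for m
  proof (cases "j \<le> m")
    case True
    have "v (of_nat (m choose j) * x ^ (m - j)) \<ge> 0"
      using padic_val_of_int_ge_0[of "int (m choose j)"] x
      by (intro padic_val_mult_ge_0 padic_val_power_ge_0) auto
    thus ?thesis using True by (simp add: coeff_linear_poly_power)
  qed (simp add: coeff_eq_0 degree_linear_power)
  \<comment> \<open>Terms below the top vanish modulo \<open>p\<close>: the constant one reaches
    only exponent \<open>0\<close>, the others have coefficients divisible by
    \<open>p\<close>.\<close>
  have low: "v (coeff f m * coeff ([:x, 1:] ^ m) j) \<ge> 1" if "m < degree f" for m
  proof (cases "m = 0")
    case True
    thus ?thesis using j by (simp add: coeff_pCons split: nat.split)
  next
    case False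
    thus ?thesis using mid[of m] that lin by (intro padic_val_mult_ge_1) auto
  qed
  have "{..degree f} = insert (degree f) {..<degree f}" by auto
  hence "coeff (pcompose f [:x, 1:]) j
      - lead_coeff f * (of_nat (degree f choose j) * x ^ (degree f - j))
    = (\<Sum>m<degree f. coeff f m * coeff ([:x, 1:] ^ m) j)"
    using j by (simp add: coeff_pcompose_sum coeff_linear_poly_power)
  thus ?thesis using low by (auto intro: padic_val_sum_ge)
qed

text \<open>Test with \<open>j = p ^ a\<close>, the full power of \<open>p\<close> in
  \<open>d = p ^ a * e\<close>: the binomial coefficient has the same multiplicity as
  \<open>e\<close>, namely \<open>0\<close>, so \<open>p ^ a < d\<close> is impossible.\<close>

lemma prime_dvd_all_choose_imp_prime_power:
  assumes "d > 1" "\<And>j. 0 < j \<Longrightarrow> j < d \<Longrightarrow> p dvd d choose j"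
  shows "\<exists>m\<ge>1. d = p ^ m"
proof -
  define a where "a = multiplicity p d"
  obtain e where e: "d = p ^ a * e" using multiplicity_dvd[of p d] by (auto simp: a_def)
  have e0: "e > 0" using e assms(1) by (cases e) auto
  have pa: "p ^ a > 0" using prime_p by (simp add: prime_gt_0_nat)
  have pe: "\<not> p dvd e"
  proof
    assume "p dvd e"
    hence "p ^ Suc a dvd d" unfolding e by (simp add: mult.commute mult_dvd_mono)
    hence "Suc a \<le> multiplicity p d"
      using assms(1) prime_gt_1_nat[OF prime_p] by (intro multiplicity_geI) auto
    thus False by (simp add: a_def)
  qed
  have "e = 1"
  proof (rule ccontr)
    assume "e \<noteq> 1"
    hence "p ^ a < d" using e e0 pa by simp
    hence "p dvd d choose (p ^ a)" using pa by (intro assms)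
    moreover have "d choose (p ^ a) \<noteq> 0" using \<open>p ^ a < d\<close> by simp
    ultimately have "multiplicity p (d choose (p ^ a)) \<noteq> 0"
      using prime_p by (simp add: prime_elem_multiplicity_eq_zero_iff)
    moreover have "multiplicity p e = 0" using pe by (rule not_dvd_imp_multiplicity_0)
    ultimately show False using const_p_fac[OF e0 prime_p, of a] e by simp
  qed
  hence "d = p ^ a" using e by simp
  moreover have "a \<noteq> 0" using \<open>d = p ^ a\<close> assms(1) by (intro notI) simp
  ultimately show ?thesis by (intro exI[of _ a]) auto
qed

lemma padic_val_poly_ge_1:
  assumes "\<And>i. v (coeff f i) \<ge> 0" "v (coeff f 0) \<ge> 1" "v x \<ge> 1"
  shows "v (poly f x) \<ge> 1"
proof -
  obtain a g where f: "f = pCons a g" by (cases f) auto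
  have "v (coeff g i) \<ge> 0" for i using assms(1)[of "Suc i"] by (simp add: f)
  moreover have "v x \<ge> 0" by (rule order.trans[OF _ assms(3)]) simp
  ultimately have "v (poly g x) \<ge> 0" by (rule padic_val_poly_ge_0)
  hence "v (x * poly g x) \<ge> 1" by (rule padic_val_mult_ge_1[OF assms(3)])
  with assms(2) have "v (a + x * poly g x) \<ge> 1" by (intro padic_val_add_ge) (simp_all add: f)
  thus ?thesis by (simp add: f)
qed

text \<open>Modulo \<open>p\<close>, the point \<open>0\<close> is fixed by
  \<open>f\<close>.\<close>

lemma coeff_0_poly_iterate_ge_1:
  assumes "\<And>i. v (coeff f i) \<ge> 0" "v (coeff f 0) \<ge> 1"
  shows "v (coeff (poly_iterate f n) 0) \<ge> 1"
proof (induction n)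
  case (Suc n)
  show ?case unfolding coeff_0_poly_iterate by (rule padic_val_poly_ge_1[OF assms Suc])
qed simp

subsection \<open>Necessity of the conditions\<close>

lemma degree_diff_const [simp]: "degree (f - [:c:]) = degree (f :: rat poly)"
proof (cases "degree f = 0")
  case True
  then obtain a where "f = [:a:]" by (rule degree_eq_zeroE)
  thus ?thesis by simp
next
  case False
  hence "degree (f + [:- c:]) = degree f" by (intro degree_add_eq_left) simp
  moreover have "f - [:c:] = f + [:- c:]" by simp
  ultimately show ?thesis by (simp only:)
qed

lemma coeff_const: "coeff [:c:] j = (if j = 0 then c else 0)"
  by (cases j) auto

lemma lead_coeff_diff_const:
  "degree f > 0 \<Longrightarrow> lead_coeff (f - [:c:]) = lead_coeff (f :: rat poly)"
  by (simp add: coeff_const)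

lemma pcompose_shift_diff_const:
  "pcompose (pcompose f [:c, 1:]) (g - [:c:]) = pcompose f (g :: rat poly)"
  by (simp add: pcompose_assoc[symmetric] pcompose_pCons)

lemma padic_integral_diff_const:
  assumes "\<And>j. v (coeff f j) \<ge> 0" "v c \<ge> 0"
  shows "v (coeff (f - [:c:]) j) \<ge> 0"
  using assms by (simp add: coeff_const padic_val_diff_ge)

lemma padic_integral_shift:
  assumes "\<And>j. v (coeff f j) \<ge> 0" "v c \<ge> 0"
  shows "v (coeff (pcompose f [:c, 1:]) j) \<ge> 0"
  using assms by (intro padic_integral_pcompose padic_integral_linear)

lemma degree_shift [simp]: "degree (pcompose f [:c, 1:]) = degree (f :: rat poly)"
  by (simp add: degree_pcompose)

lemma lead_coeff_shift [simp]: "coeff (pcompose f [:c, 1:]) (degree f) = lead_coeff (f :: rat poly)"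
  using lead_coeff_comp[of "[:c, 1:]" f] by simp

text \<open>The splitting \<open>f(g(x)) = f(y + c)\<close> at \<open>y = g(x) - c\<close> with \<open>c = g(0)\<close>, to which the previous cancellation applies.\<close>

lemma newton_init_pcompose_split:
  assumes f: "\<And>j. v (coeff f j) \<ge> 0" "v (lead_coeff f) = 0" "degree f > 0"
    and g: "\<And>j. v (coeff g j) \<ge> 0" "v (lead_coeff g) = 0" "degree g > 0"
    and comp: "newton_init 0 0 (degree f * degree g) (pcompose f g)"
    and c: "c = coeff g 0"
  shows "newton_init 0 0 (degree f) (pcompose f [:c, 1:])"
    "newton_init 0 0 (degree g) (g - [:c:])"
proof -
  have c0: "v c \<ge> 0" using g(1) c by simp
  have lead: "v (lead_coeff (g - [:c:])) = 0" "v (lead_coeff (pcompose f [:c, 1:])) = 0"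
    using lead_coeff_diff_const[OF g(3)] g(2) f(2) by simp_all
  have comp': "newton_init 0 0 (degree (pcompose (pcompose f [:c, 1:]) (g - [:c:])))
      (pcompose (pcompose f [:c, 1:]) (g - [:c:]))"
    using comp by (simp add: pcompose_shift_diff_const degree_pcompose)
  have const: "coeff (g - [:c:]) 0 = 0" "degree (pcompose f [:c, 1:]) > 0"
    using c f(3) by simp_all
  note * = newton_init_pcompose_cancel[OF padic_integral_shift[OF f(1) c0] lead(2)
      padic_integral_diff_const[OF g(1) c0] lead(1) const comp']
  show "newton_init 0 0 (degree f) (pcompose f [:c, 1:])"
    "newton_init 0 0 (degree g) (g - [:c:])"
    using * by simp_all
qed

lemma eventually_pure_imp:
  assumes r: "r > 0" and not_pure: "\<not> pure_poly p r f" and deg: "degree f > r"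
    and ev: "eventually_pure p r f"
  shows "\<exists>m\<ge>1. degree f = p ^ m"
    and "v (lead_coeff f) = 0" and "v (coeff f 0) = 0"
    and "\<And>j. 0 < j \<Longrightarrow> j < degree f \<Longrightarrow> v (coeff f j) \<ge> 1"
    and "\<exists>c. pure_poly p r (pcompose f [:c, 1:])"
proof -
  from ev obtain n where n: "n \<ge> 1" "pure_poly p r (poly_iterate f n)"
    by (auto simp: eventually_pure_def)
  \<comment> \<open>Excluding \<open>n = 1\<close> leaves a proper iterate after splitting off one
    \<open>f\<close> on either side.\<close>
  have "n \<noteq> 1" using n(2) not_pure by (auto simp: poly_iterate_Suc)
  with n(1) obtain k where nk: "n = Suc (Suc k)" by (metis One_nat_def Suc_le_D not0_implies_Suc)
  have pure: "pure_poly p r (poly_iterate f (Suc (Suc k)))" using n(2) by (simp only: nk)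
  have d1: "degree f > 1" and d0: "degree f > 0" using r deg by simp_all
  note int = poly_iterate_pure_imp_integral(2)[OF d1 pure]
  show lead: "v (lead_coeff f) = 0" by (rule poly_iterate_pure_imp_integral(1)[OF d1 pure])
  define b where "b = coeff f 0"
  let ?g = "poly_iterate f (Suc k)"
  define c where "c = coeff ?g 0"
  have gdeg: "degree ?g > 0" using d0 by (simp add: degree_poly_iterate)
  have glead: "v (lead_coeff ?g) = 0" using padic_val_lead_coeff_poly_iterate[OF d0] lead by simp
  note gint = padic_integral_poly_iterate[OF int]
  have b0: "v b \<ge> 0" using int by (simp add: b_def)
  have degn: "degree (poly_iterate f (Suc (Suc k))) > 0" using d0 by (simp add: degree_poly_iterate)
  have "newton_init 0 (0 * real (degree (poly_iterate f (Suc (Suc k)))))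
      (degree (poly_iterate f (Suc (Suc k)))) (poly_iterate f (Suc (Suc k)))"
    using r degn by (intro pure_poly_newton_init[OF degn pure]) simp
  hence init: "newton_init 0 0 (degree f * degree ?g) (poly_iterate f (Suc (Suc k)))"
    by (simp add: degree_poly_iterate)

  \<comment> \<open>Splitting off the innermost \<open>f\<close>.\<close>
  have A: "newton_init 0 0 (degree ?g) (pcompose ?g [:b, 1:])"
      "newton_init 0 0 (degree f) (f - [:b:])"
    using init
    by (intro newton_init_pcompose_split[OF gint glead gdeg int lead d0 _ b_def];
        simp add: poly_iterate_Suc_right mult.commute)+
  \<comment> \<open>Splitting off the outermost \<open>f\<close>; this makes
    \<open>?g - [:c:]\<close> an inner factor that can be removed without losing purity.\<close>
  have B: "newton_init 0 0 (degree ?g) (?g - [:c:])"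
    using init
    by (intro newton_init_pcompose_split(2)[OF int lead d0 gint glead gdeg _ c_def])
       (simp add: poly_iterate_Suc)

  show mid: "v (coeff f j) \<ge> 1" if "0 < j" "j < degree f" for j
    using newton_init_0_coeff_ge_1[OF A(2) that(2)] that(1) by (simp add: coeff_const)

  have F: "pure_poly p r (pcompose f [:c, 1:])"
  proof (rule pure_poly_pcompose_outer[where h = "?g - [:c:]"])
    show "pure_poly p r (pcompose (pcompose f [:c, 1:]) (?g - [:c:]))"
      using pure by (simp add: pcompose_shift_diff_const poly_iterate_Suc)
    show "v (lead_coeff (?g - [:c:])) = 0" using glead lead_coeff_diff_const[OF gdeg] by simp
    show "v (coeff (?g - [:c:]) j) \<ge> 1" if "j < degree (?g - [:c:])" for j
      using newton_init_0_coeff_ge_1[OF B] that by simp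
  qed (use lead deg gdeg in \<open>simp_all add: c_def\<close>)
  thus "\<exists>c. pure_poly p r (pcompose f [:c, 1:])" by blast

  \<comment> \<open>If \<open>p\<close> divided \<open>f(0)\<close>, it would divide
    \<open>c\<close>, and undoing the shift by \<open>c\<close> would make \<open>f\<close> itself
    pure.\<close>
  show unit: "v (coeff f 0) = 0"
  proof (rule ccontr)
    assume "v (coeff f 0) \<noteq> 0"
    with int[of 0] have "v (coeff f 0) > 0" by simp
    hence "v (coeff f 0) \<ge> 1" by (rule padic_val_gt_0_imp_ge_1)
    from coeff_0_poly_iterate_ge_1[OF int this] have "v (- c) \<ge> 1" by (simp add: c_def)
    from pure_poly_shift[OF _ F this] deg
    have "pure_poly p r (pcompose (pcompose f [:c, 1:]) [:- c, 1:])" by simp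
    moreover have "pcompose (pcompose f [:c, 1:]) [:- c, 1:] = f"
      by (simp add: pcompose_assoc[symmetric] pcompose_pCons)
    ultimately show False using not_pure by simp
  qed

  let ?h = "pcompose f [:b, 1:]"
  \<comment> \<open>The monomial \<open>f^(k+1)(x + b)\<close> of \<open>A\<close> equals
    \<open>f^k\<close> composed with \<open>?h\<close>, so the splitting applies once more, now with
    \<open>?h\<close> inside.\<close>
  have C: "newton_init 0 0 (degree f) (?h - [:coeff ?h 0:])"
  proof -
    have hint: "\<And>j. v (coeff ?h j) \<ge> 0" using int b0 by (rule padic_integral_shift)
    have kdeg: "degree (poly_iterate f k) > 0" using d0 by (simp add: degree_poly_iterate)
    have klead: "v (lead_coeff (poly_iterate f k)) = 0"
      using padic_val_lead_coeff_poly_iterate[OF d0] lead by (cases k) auto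
    have "newton_init 0 0 (degree ?h) (?h - [:coeff ?h 0:])"
      using A(1) lead d0
      by (intro newton_init_pcompose_split(2)[OF gint klead kdeg hint _ _ _ refl])
         (simp_all add: degree_poly_iterate degree_pcompose poly_iterate_Suc_right pcompose_assoc mult.commute)
    thus ?thesis by simp
  qed

  show "\<exists>m\<ge>1. degree f = p ^ m"
  proof (rule prime_dvd_all_choose_imp_prime_power[OF d1])
    fix j assume j: "0 < j" "j < degree f"
    \<comment> \<open>This coefficient is also congruent to \<open>a_d (d choose j) b^(d-j)\<close>,
      where \<open>a_d\<close> and \<open>b\<close> are units.\<close>
    have "v (coeff ?h j) \<ge> 1"
      using newton_init_0_coeff_ge_1[OF C j(2)] j(1) by (simp add: coeff_const)
    from padic_val_diff_ge[OF this coeff_shift_cong[OF mid b0 j]]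
    have "v (lead_coeff f * (of_nat (degree f choose j) * b ^ (degree f - j))) \<ge> 1" by simp
    moreover have "v (b ^ (degree f - j)) = 0"
      using padic_val_power[of b 0] unit by (simp add: b_def zero_ereal_def)
    ultimately have "v (of_nat (degree f choose j)) \<ge> 1"
      using lead by (simp add: padic_val_mult)
    thus "p dvd degree f choose j" by (simp add: padic_val_of_nat_ge_1_iff)
  qed
qed

subsection \<open>Congruences and sufficiency of the conditions\<close>

lemma padic_cong_refl [simp]: "padic_cong p x x"
  by (simp add: padic_cong_def)

lemma padic_cong_sym: "padic_cong p x y \<Longrightarrow> padic_cong p y x"
  by (simp add: padic_cong_def padic_val_diff_commute)

lemma padic_cong_trans:
  assumes "padic_cong p x y" "padic_cong p y z"
  shows "padic_cong p x z"
  using padic_val_add_ge[of 1 "x - y" "y - z"] assms by (simp add: padic_cong_def)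

lemma padic_cong_add:
  assumes "padic_cong p x y" "padic_cong p x' y'"
  shows "padic_cong p (x + x') (y + y')"
  using padic_val_add_ge[of 1 "x - y" "x' - y'"] assms by (simp add: padic_cong_def algebra_simps)

lemma padic_cong_mult:
  assumes "padic_cong p x y" "padic_cong p x' y'" "v x' \<ge> 0" "v y \<ge> 0"
  shows "padic_cong p (x * x') (y * y')"
proof -
  have "v ((x - y) * x' + (x' - y') * y) \<ge> 1"
    using assms by (intro padic_val_add_ge padic_val_mult_ge_1) (auto simp: padic_cong_def)
  moreover have "(x - y) * x' + (x' - y') * y = x * x' - y * y'" by (simp add: algebra_simps)
  ultimately show ?thesis by (simp add: padic_cong_def)
qed

lemma padic_cong_power:
  assumes "padic_cong p x y" "v x \<ge> 0" "v y \<ge> 0"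
  shows "padic_cong p (x ^ n) (y ^ n)"
  using assms by (induction n) (auto intro!: padic_cong_mult padic_val_power_ge_0)

lemma padic_cong_0_iff: "padic_cong p x 0 \<longleftrightarrow> v x \<ge> 1"
  by (simp add: padic_cong_def)

lemma padic_val_ge_1_cong: "padic_cong p x y \<Longrightarrow> v x \<ge> 1 \<longleftrightarrow> v y \<ge> 1"
  using padic_cong_trans padic_cong_sym unfolding padic_cong_0_iff[symmetric] by blast

section \<open>Residues modulo \<open>p\<close> and Fermat's congruence\<close>

lemma padic_val_of_nat_ge_0: "v (of_nat n) \<ge> 0"
  using padic_val_of_int_ge_0[of "int n"] by simp

text \<open>The denominator of a \<open>p\<close>-integral number is invertible modulo
  \<open>p\<close>. This reduces Fermat's congruence to natural numbers.\<close>

lemma padic_residue: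
  assumes "v x \<ge> 0"
  obtains n :: nat where "padic_cong p x (of_nat n)"
proof (cases "x = 0")
  case True
  thus ?thesis using that[of 0] by simp
next
  case False
  obtain a q where aq: "quotient_of x = (a, q)" by force
  note x = quotient_of_div[OF aq] and q = quotient_of_denom_pos[OF aq]
    and cop = quotient_of_coprime[OF aq]
  have a: "a \<noteq> 0" using x False by auto
  have nd: "\<not> int p dvd q"
  proof
    assume pq: "int p dvd q"
    hence "\<not> int p dvd a" using cop prime_p
      by (metis coprime_common_divisor not_prime_unit prime_nat_int_transfer)
    hence "multiplicity (int p) a = 0" by (rule not_dvd_imp_multiplicity_0)
    moreover have "multiplicity (int p) q \<noteq> 0"
      using pq q prime_elem_multiplicity_eq_zero_iff[OF prime_elem_int_p] by auto
    ultimately show False using assms padic_val_fraction[of a q] a q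
      by (simp add: x zero_ereal_def)
  qed
  hence "coprime (int p) q" using prime_p by (intro prime_imp_coprime) auto
  then obtain u where u: "[q * u = 1] (mod int p)"
    using cong_solve_coprime_int[of q "int p"] by (auto simp: coprime_commute)
  define n where "n = nat ((a * u) mod int p)"
  have n: "int n = (a * u) mod int p" using prime_gt_0_nat[OF prime_p] by (simp add: n_def)
  have "[int n * q = a * (q * u)] (mod int p)"
    using cong_scalar_right[of "int n" "a * u" "int p" q] by (simp add: n mult_ac)
  also have "[a * (q * u) = a * 1] (mod int p)" using u by (rule cong_scalar_left)
  finally have "int p dvd int n * q - a" by (simp add: cong_iff_dvd_diff)
  hence "v (of_int (int n * q - a)) \<ge> 1" by (simp only: padic_val_of_int_ge_1_iff)
  moreover have "of_int (int n * q - a) = (of_nat n - x) * of_int q"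
    using x q by (simp add: field_simps)
  moreover have "v (of_int q) = 0"
    using q nd by (simp add: padic_val_of_int not_dvd_imp_multiplicity_0 zero_ereal_def)
  ultimately have "padic_cong p (of_nat n) x"
    by (simp add: padic_val_mult padic_cong_def)
  thus ?thesis using that padic_cong_sym by blast
qed

text \<open>By \<open>j * (d choose j) = d * (d - 1 choose j - 1)\<close> with
  \<open>d = p ^ m\<close>, a binomial coefficient prime to \<open>p\<close> would make
  \<open>p ^ m\<close> divide \<open>j\<close>.\<close>

lemma prime_dvd_choose_prime_power:
  assumes "0 < j" "j < p ^ m"
  shows "p dvd p ^ m choose j"
proof (rule ccontr)
  assume "\<not> ?thesis"
  hence "coprime (p ^ m) (p ^ m choose j)"
    using prime_p by (intro coprime_power_left_iff[THEN iffD2] disjI1 prime_imp_coprime) auto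
  moreover have "p ^ m dvd j * (p ^ m choose j)"
    using times_binomial_minus1_eq[OF assms(1), of "p ^ m"] by simp
  ultimately have "p ^ m dvd j" by (simp add: coprime_dvd_mult_left_iff)
  thus False using assms by (auto dest: dvd_imp_le)
qed

text \<open>Induction on \<open>n\<close>, since raising to the power \<open>p ^ m\<close> is
  additive modulo \<open>p\<close>.\<close>

lemma prime_power_fermat_nat:
  assumes "m \<ge> 1"
  shows "[n ^ (p ^ m) = n] (mod p)"
proof (induction n)
  case 0
  show ?case using prime_gt_0_nat[OF prime_p] by (simp add: power_0_left)
next
  case (Suc n)
  let ?d = "p ^ m"
  have d: "?d > 0" using prime_gt_0_nat[OF prime_p] by simp
  have "Suc n ^ ?d = (n + 1) ^ ?d" by simp
  also have "\<dots> = (\<Sum>k\<le>?d. (?d choose k) * n ^ k)"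
    by (subst binomial) simp
  also have "{..?d} = insert 0 (insert ?d {1..<?d})" using d by auto
  also have "(\<Sum>k\<in>insert 0 (insert ?d {1..<?d}). (?d choose k) * n ^ k)
      = 1 + (n ^ ?d + (\<Sum>k=1..<?d. (?d choose k) * n ^ k))"
    using d by simp
  finally have eq: "Suc n ^ ?d = 1 + (n ^ ?d + (\<Sum>k=1..<?d. (?d choose k) * n ^ k))" .
  have "p dvd (\<Sum>k=1..<?d. (?d choose k) * n ^ k)"
    by (intro dvd_sum dvd_mult2 prime_dvd_choose_prime_power) auto
  hence "[1 + (n ^ ?d + (\<Sum>k=1..<?d. (?d choose k) * n ^ k)) = 1 + (n + 0)] (mod p)"
    by (intro cong_add Suc) (auto simp: cong_0_iff)
  thus ?case by (simp only: eq) simp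
qed

lemma padic_fermat:
  assumes "v x \<ge> 0" "m \<ge> 1"
  shows "padic_cong p (x ^ (p ^ m)) x"
proof -
  obtain n where n: "padic_cong p x (of_nat n)" using padic_residue[OF assms(1)] .
  have 1: "padic_cong p (x ^ (p ^ m)) (of_nat n ^ (p ^ m))"
    by (rule padic_cong_power[OF n assms(1) padic_val_of_nat_ge_0])
  have "[int (n ^ (p ^ m)) = int n] (mod int p)"
    using prime_power_fermat_nat[OF assms(2)] by (simp only: cong_int_iff)
  hence "int p dvd int (n ^ (p ^ m)) - int n" by (simp only: cong_iff_dvd_diff)
  hence "v (of_int (int (n ^ (p ^ m)) - int n)) \<ge> 1" by (simp only: padic_val_of_int_ge_1_iff)
  hence "padic_cong p (of_nat n ^ (p ^ m)) (of_nat n)" by (simp add: padic_cong_def)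
  from padic_cong_trans[OF 1 padic_cong_trans[OF this padic_cong_sym[OF n]]] show ?thesis .
qed

section \<open>Iterates of a polynomial satisfying the three conditions\<close>

context
  fixes f :: "rat poly" and m r :: nat and c :: rat
  assumes r: "r > 0" and deg_gt: "degree f > r"
    and m: "m \<ge> 1" and deg: "degree f = p ^ m"
    and lead: "v (lead_coeff f) = 0" and const: "v (coeff f 0) = 0"
    and mid: "\<And>j. 0 < j \<Longrightarrow> j < degree f \<Longrightarrow> v (coeff f j) \<ge> 1"
    and pure: "pure_poly p r (pcompose f [:c, 1:])"
begin

lemma deg_pos: "degree f > 0"
  using deg_gt by simp

lemma padic_integral_coeff: "v (coeff f j) \<ge> 0"
proof -
  consider "j = 0" | "0 < j" "j < degree f" | "j = degree f" | "j > degree f" by linarith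
  thus ?thesis
  proof cases
    case 2
    show ?thesis by (rule order.trans[OF _ mid[OF 2]]) simp
  qed (use lead const in \<open>auto simp: coeff_eq_0\<close>)
qed

text \<open>The middle terms vanish modulo \<open>p\<close>, and Fermat's congruence replaces
  \<open>x ^ degree f\<close> by \<open>x\<close>.\<close>

lemma poly_cong_affine:
  assumes "v x \<ge> 0"
  shows "padic_cong p (poly f x) (lead_coeff f * x + coeff f 0)"
proof -
  have "{..degree f} = insert 0 (insert (degree f) {0<..<degree f})" using deg_pos by auto
  hence eq: "poly f x = (\<Sum>i\<in>{0<..<degree f}. coeff f i * x ^ i)
      + (lead_coeff f * x ^ degree f + coeff f 0)"
    using deg_pos by (simp add: poly_altdef)
  have "v (\<Sum>i\<in>{0<..<degree f}. coeff f i * x ^ i) \<ge> 1"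
    using assms mid by (intro padic_val_sum_ge padic_val_mult_ge_1 padic_val_power_ge_0) auto
  hence 1: "padic_cong p (\<Sum>i\<in>{0<..<degree f}. coeff f i * x ^ i) 0"
    by (simp add: padic_cong_0_iff)
  have "padic_cong p (lead_coeff f * x ^ degree f) (lead_coeff f * x)"
    unfolding deg using padic_fermat[OF assms m] assms padic_integral_coeff
    by (intro padic_cong_mult padic_val_power_ge_0) auto
  from padic_cong_add[OF 1 padic_cong_add[OF this padic_cong_refl[of "coeff f 0"]]]
  show ?thesis unfolding eq by simp
qed

lemma const_iterate_ge_0: "v (coeff (poly_iterate f n) 0) \<ge> 0"
  using padic_integral_coeff by (rule padic_integral_poly_iterate)

lemma const_iterate_cong:
  "padic_cong p (coeff (poly_iterate f n) 0) (coeff f 0 * (\<Sum>i<n. lead_coeff f ^ i))"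
proof (induction n)
  case (Suc n)
  let ?x = "coeff (poly_iterate f n) 0"
  have "padic_cong p (lead_coeff f * ?x) (lead_coeff f * (coeff f 0 * (\<Sum>i<n. lead_coeff f ^ i)))"
    using Suc const_iterate_ge_0[of n] lead by (intro padic_cong_mult) auto
  hence "padic_cong p (lead_coeff f * ?x + coeff f 0)
      (lead_coeff f * (coeff f 0 * (\<Sum>i<n. lead_coeff f ^ i)) + coeff f 0)"
    by (intro padic_cong_add padic_cong_refl)
  moreover have "lead_coeff f * (coeff f 0 * (\<Sum>i<n. lead_coeff f ^ i)) + coeff f 0
      = coeff f 0 * (\<Sum>i<Suc n. lead_coeff f ^ i)"
    by (subst sum.lessThan_Suc_shift) (simp add: algebra_simps sum_distrib_left)
  ultimately show ?case
    unfolding coeff_0_poly_iterate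
    using padic_cong_trans[OF poly_cong_affine[OF const_iterate_ge_0]] by metis
qed simp

text \<open>For \<open>c\<close> of negative valuation the leading term dominates
  \<open>f(c)\<close> and makes its valuation negative, but \<open>f(c)\<close> is the constant
  coefficient of a pure polynomial.\<close>

lemma shift_ge_0: "v c \<ge> 0"
proof (rule ccontr)
  assume neg: "\<not> ?thesis"
  hence "c \<noteq> 0" by auto
  then obtain t :: int where t: "v c = ereal (of_int t)" by (rule padic_val_eq_int)
  have t0: "real_of_int t < 0" using neg t by (simp add: zero_ereal_def)
  have "v (poly f c) = ereal (real (degree f) * of_int t)"
    unfolding poly_altdef
  proof (rule padic_val_sum_eq[where j = "degree f"])
    show "v (lead_coeff f * c ^ degree f) = ereal (real (degree f) * of_int t)"
      using lead padic_val_power[OF t] by (simp add: padic_val_mult)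
    fix i assume "i \<in> {..degree f}" "i \<noteq> degree f"
    hence "real (degree f) * of_int t < real i * of_int t"
      using t0 by (intro mult_strict_right_mono_neg) auto
    moreover have "v (coeff f i * c ^ i) \<ge> ereal (0 + real i * of_int t)"
      using padic_integral_coeff padic_val_power[OF t]
      by (intro padic_val_mult_ge) (auto simp: zero_ereal_def[symmetric])
    ultimately show "v (coeff f i * c ^ i) > ereal (real (degree f) * of_int t)"
      by (metis add_0 less_ereal.simps(1) less_le_trans)
  qed auto
  moreover have "v (poly f c) = ereal (real r)"
    using pure deg_pos by (simp add: pure_poly_iff)
  ultimately have "real (degree f) * of_int t = real r" by simp
  thus False using t0 deg_pos r by (smt (verit) mult_nonneg_nonpos of_nat_0_le_iff of_nat_0_less_iff)
qed

text \<open>Modulo \<open>p\<close>, \<open>f(y + x) - f(x)\<close> is \<open>a_d y^d\<close>, as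
  \<open>p\<close> divides the inner binomial coefficients of a power of \<open>p\<close>.\<close>

lemma newton_init_shift_diff_const:
  assumes "v x \<ge> 0"
  shows "newton_init 0 0 (degree f) (pcompose f [:x, 1:] - [:poly f x:])"
proof -
  let ?g = "pcompose f [:x, 1:] - [:poly f x:]"
  have int: "v (coeff (pcompose f [:x, 1:]) j) \<ge> 0" for j
    using padic_integral_coeff assms by (rule padic_integral_shift)
  have low: "v (coeff ?g j) \<ge> 1" if "j < degree f" for j
  proof (cases "j = 0")
    case False
    have "v (of_nat (degree f choose j)) \<ge> 1"
      using prime_dvd_choose_prime_power[of j m] False that deg
      by (simp add: padic_val_of_nat_ge_1_iff)
    hence "v (lead_coeff f * (of_nat (degree f choose j) * x ^ (degree f - j))) \<ge> 1"
      using padic_val_mult_ge_1[OF _ padic_val_power_ge_0[OF assms]] lead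
      by (simp add: padic_val_mult)
    from padic_val_add_ge[OF coeff_shift_cong[OF mid assms _ that] this] False
    have "v (coeff (pcompose f [:x, 1:]) j) \<ge> 1" by simp
    thus ?thesis using False by (simp add: coeff_const)
  qed simp
  show ?thesis
  proof (rule newton_initI)
    show "v (coeff ?g (degree f)) = ereal (0 - 0 * real (degree f))"
      using lead deg_pos by (simp add: coeff_const zero_ereal_def)
    show "v (coeff ?g j) > ereal (0 - 0 * real j)" if "j < degree f" for j
      by (rule less_le_trans[OF _ low[OF that]]) simp
    show "v (coeff ?g j) \<ge> ereal (0 - 0 * real j)" for j
      using padic_integral_diff_const[OF int padic_val_poly_ge_0[OF padic_integral_coeff assms]]
      by (simp add: zero_ereal_def)
  qed
qed

text \<open>The difference for \<open>n + 1\<close> is \<open>f(y + x) - f(x)\<close> with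
  \<open>x = f^n(0)\<close>, composed with the difference for \<open>n\<close>; monomials compose to
  monomials.\<close>

lemma newton_init_iterate_diff_const:
  "newton_init 0 0 (degree f ^ n) (poly_iterate f n - [:coeff (poly_iterate f n) 0:])"
proof (induction n)
  case 0
  show ?case by (rule newton_initI) (auto simp: coeff_pCons zero_ereal_def split: nat.split)
next
  case (Suc n)
  let ?x = "coeff (poly_iterate f n) 0"
  have eq: "pcompose (pcompose f [:?x, 1:] - [:poly f ?x:]) (poly_iterate f n - [:?x:])
      = poly_iterate f (Suc n) - [:coeff (poly_iterate f (Suc n)) 0:]"
    by (simp add: pcompose_diff pcompose_shift_diff_const poly_iterate_Suc)
  show ?case
    using newton_init_pcompose[OF newton_init_shift_diff_const[OF const_iterate_ge_0[of n]] Suc] deg_pos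
    unfolding eq by (simp add: mult.commute)
qed

lemma pure_iterate_iff:
  "pure_poly p r (poly_iterate f (Suc n)) \<longleftrightarrow> v (coeff (poly_iterate f (Suc n)) 0) \<ge> 1"
proof
  assume "pure_poly p r (poly_iterate f (Suc n))"
  thus "v (coeff (poly_iterate f (Suc n)) 0) \<ge> 1"
    using r by (simp add: pure_poly_def one_ereal_def)
next
  let ?x = "coeff (poly_iterate f n) 0" and ?a = "lead_coeff f" and ?b = "coeff f 0"
  assume "v (coeff (poly_iterate f (Suc n)) 0) \<ge> 1"
  hence "v (poly f ?x) \<ge> 1" by (simp add: coeff_0_poly_iterate)
  hence x: "v (?a * ?x + ?b) \<ge> 1"
    using padic_val_ge_1_cong[OF poly_cong_affine[OF const_iterate_ge_0]] by blast
  have "v (poly f c) \<ge> 1"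
    using pure deg_pos r by (simp add: pure_poly_iff one_ereal_def)
  hence "v (?a * c + ?b) \<ge> 1"
    using padic_val_ge_1_cong[OF poly_cong_affine[OF shift_ge_0]] by blast
  \<comment> \<open>Both \<open>?x\<close> and \<open>c\<close> are roots of \<open>a x + b\<close>
    modulo \<open>p\<close> with \<open>a\<close> a unit, so they are congruent and
    \<open>?x\<close> can replace \<open>c\<close> as the shift.\<close>
  from padic_val_diff_ge[OF x this] have "v (?a * (?x - c)) \<ge> 1" by (simp add: algebra_simps)
  hence xc: "v (?x - c) \<ge> 1" using lead by (simp add: padic_val_mult)
  have "pcompose (pcompose f [:c, 1:]) [:?x - c, 1:] = pcompose f [:?x, 1:]"
    by (simp add: pcompose_assoc[symmetric] pcompose_pCons)
  with pure_poly_shift[OF _ pure xc] deg_gt have F: "pure_poly p r (pcompose f [:?x, 1:])" by simp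
  have degn: "degree (poly_iterate f n) = degree f ^ n" by (rule degree_poly_iterate)
  have pos: "degree (poly_iterate f n) > 0" using deg_pos degn by simp
  have "pure_poly p r (pcompose (pcompose f [:?x, 1:]) (poly_iterate f n - [:?x:]))"
  proof (rule pure_poly_pcompose[OF F])
    show "v (lead_coeff (poly_iterate f n - [:?x:])) = 0"
      unfolding lead_coeff_diff_const[OF pos]
      using padic_val_lead_coeff_poly_iterate[OF deg_pos] lead by (cases n) auto
    show "v (coeff (poly_iterate f n - [:?x:]) j) \<ge> 1" if "j < degree (poly_iterate f n - [:?x:])" for j
      using that by (intro newton_init_0_coeff_ge_1[OF newton_init_iterate_diff_const]) (simp add: degn)
  qed (use deg_gt pos in simp_all)
  thus "pure_poly p r (poly_iterate f (Suc n))"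
    by (simp add: pcompose_shift_diff_const poly_iterate_Suc)
qed

text \<open>The geometric sum must vanish modulo \<open>p\<close>. It is congruent to
  \<open>n\<close> if \<open>a\<close> is congruent to \<open>1\<close>; otherwise
  \<open>a - 1\<close> is a unit and multiplying by it gives \<open>a^n - 1\<close>.\<close>

lemma pure_iterate_iff_lead_coeff:
  assumes "n \<ge> 1"
  shows "pure_poly p r (poly_iterate f n) \<longleftrightarrow>
    (if padic_cong p (lead_coeff f) 1 then p dvd n else padic_cong p (lead_coeff f ^ n) 1)"
proof -
  let ?a = "lead_coeff f"
  obtain k where k: "n = Suc k" using assms by (cases n) auto
  have a0: "v ?a \<ge> 0" using lead by simp
  have "pure_poly p r (poly_iterate f n) \<longleftrightarrow> v (coeff f 0 * (\<Sum>i<n. ?a ^ i)) \<ge> 1"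
    unfolding k pure_iterate_iff by (rule padic_val_ge_1_cong[OF const_iterate_cong])
  also have "\<dots> \<longleftrightarrow> v (\<Sum>i<n. ?a ^ i) \<ge> 1" using const by (simp add: padic_val_mult)
  also have "\<dots> \<longleftrightarrow> (if padic_cong p ?a 1 then p dvd n else padic_cong p (?a ^ n) 1)"
  proof (cases "padic_cong p ?a 1")
    case True
    have "padic_cong p (\<Sum>i<n. ?a ^ i) (of_nat n)"
    proof (induction n)
      case (Suc n)
      have "padic_cong p (?a ^ n) (1 ^ n)" using True a0 by (intro padic_cong_power) auto
      from padic_cong_add[OF Suc this] show ?case by (simp add: add.commute)
    qed simp
    from padic_val_ge_1_cong[OF this] True show ?thesis by (simp add: padic_val_of_nat_ge_1_iff)
  next
    case False
    have "v (?a - 1) \<ge> 0" using a0 by (intro padic_val_diff_ge) auto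
    moreover have "\<not> v (?a - 1) > 0"
      using False padic_val_gt_0_imp_ge_1 by (auto simp: padic_cong_def)
    ultimately have "v (?a - 1) = 0" by simp
    hence "v (\<Sum>i<n. ?a ^ i) = v ((?a - 1) * (\<Sum>i<n. ?a ^ i))" by (simp add: padic_val_mult)
    also have "(?a - 1) * (\<Sum>i<n. ?a ^ i) = ?a ^ n - 1" by (rule power_diff_1_eq[symmetric])
    finally show ?thesis using False by (simp add: padic_cong_def)
  qed
  finally show ?thesis .
qed

text \<open>The witness is \<open>p\<close> if \<open>a\<close> is congruent to \<open>1\<close>,
  and otherwise \<open>degree f - 1\<close>, by cancelling the unit \<open>a\<close> in Fermat's
  congruence.\<close>

lemma eventually_pureI: "eventually_pure p r f"
proof (cases "padic_cong p (lead_coeff f) 1")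
  case True
  hence "pure_poly p r (poly_iterate f p)"
    using prime_ge_1_nat[OF prime_p] by (subst pure_iterate_iff_lead_coeff) auto
  thus ?thesis using prime_ge_1_nat[OF prime_p] by (auto simp: eventually_pure_def)
next
  case False
  let ?a = "lead_coeff f"
  have ge: "degree f - 1 \<ge> 1" using deg_gt r by simp
  have "?a ^ degree f = ?a * ?a ^ (degree f - 1)" using deg_pos by (simp add: power_eq_if)
  moreover have "padic_cong p (?a ^ degree f) ?a"
    using padic_fermat[OF _ m, of ?a] lead by (simp add: deg)
  ultimately have "v (?a * (?a ^ (degree f - 1) - 1)) \<ge> 1"
    by (simp add: padic_cong_def algebra_simps)
  hence "padic_cong p (?a ^ (degree f - 1)) 1" using lead by (simp add: padic_val_mult padic_cong_def)
  hence "pure_poly p r (poly_iterate f (degree f - 1))"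
    using ge False by (subst pure_iterate_iff_lead_coeff) auto
  thus ?thesis using ge by (auto simp: eventually_pure_def)
qed

lemma least_pure_iterate:
  "(LEAST n. n > 1 \<and> pure_poly p r (poly_iterate f n)) =
    (if padic_cong p (lead_coeff f) 1 then p else padic_ord p (lead_coeff f))"
proof (cases "padic_cong p (lead_coeff f) 1")
  case True
  have "(LEAST n. n > 1 \<and> pure_poly p r (poly_iterate f n)) = p"
  proof (rule Least_equality)
    show "p > 1 \<and> pure_poly p r (poly_iterate f p)"
      using prime_gt_1_nat[OF prime_p] True by (auto simp: pure_iterate_iff_lead_coeff)
    show "p \<le> n" if "n > 1 \<and> pure_poly p r (poly_iterate f n)" for n
      using that True pure_iterate_iff_lead_coeff[of n] by (auto dest: dvd_imp_le)
  qed
  thus ?thesis using True by simp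
next
  case False
  \<comment> \<open>Exponent \<open>1\<close> fails on the right because \<open>a\<close> is not
    congruent to \<open>1\<close>, so the bounds \<open>n > 1\<close> and \<open>n \<ge> 1\<close>
    select the same numbers.\<close>
  have "(n > 1 \<and> pure_poly p r (poly_iterate f n)) \<longleftrightarrow>
      (n \<ge> 1 \<and> padic_cong p (lead_coeff f ^ n) 1)" for n
    using False pure_iterate_iff_lead_coeff[of n] by (cases "n = 1") auto
  thus ?thesis using False by (simp add: padic_ord_def)
qed

end

end

theorem theorem5p6:
  fixes f :: "rat poly" and p r :: nat
  assumes "r > 0" and "prime p"
    and "\<not> pure_poly p r f"
    and "degree f > r"
  shows "(eventually_pure p r f \<longleftrightarrow>
            (\<exists>m\<ge>1. degree f = p ^ m) \<and>
            (padic_val p (lead_coeff f) = 0 \<and> padic_val p (coeff f 0) = 0 \<and>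
               (\<forall>i\<in>{1..degree f - 1}. padic_val p (coeff f i) \<ge> 1)) \<and>
            (\<exists>c::rat. pure_poly p r (pcompose f [:c, 1:])))
       \<and> (eventually_pure p r f \<longrightarrow>
            (LEAST n. n > 1 \<and> pure_poly p r (poly_iterate f n)) =
              (if padic_cong p (lead_coeff f) 1 then p else padic_ord p (lead_coeff f)))"
proof -
  let ?C = "(\<exists>m\<ge>1. degree f = p ^ m) \<and>
            (padic_val p (lead_coeff f) = 0 \<and> padic_val p (coeff f 0) = 0 \<and>
               (\<forall>i\<in>{1..degree f - 1}. padic_val p (coeff f i) \<ge> 1)) \<and>
            (\<exists>c::rat. pure_poly p r (pcompose f [:c, 1:]))"
  have fwd: ?C if "eventually_pure p r f"
  proof -
    note * = eventually_pure_imp[OF assms(2,1,3,4) that]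
    have "padic_val p (coeff f i) \<ge> 1" if "i \<in> {1..degree f - 1}" for i
      using that by (intro *(4)) auto
    with * show ?thesis by blast
  qed
  \<comment> \<open>The conditions yield both conclusions; the least index for an eventually pure
    \<open>f\<close> is then reached through \<open>fwd\<close>.\<close>
  have bwd: "eventually_pure p r f \<and>
      (LEAST n. n > 1 \<and> pure_poly p r (poly_iterate f n)) =
        (if padic_cong p (lead_coeff f) 1 then p else padic_ord p (lead_coeff f))" if C: ?C
  proof -
    from C obtain m c where mc: "m \<ge> 1" "degree f = p ^ m" "pure_poly p r (pcompose f [:c, 1:])"
      by blast
    have mid: "padic_val p (coeff f j) \<ge> 1" if "0 < j" "j < degree f" for j
      using C that by (simp add: Suc_le_eq less_imp_le)
    show ?thesis
      using eventually_pureI[OF assms(2,1,4) mc(1,2) _ _ mid mc(3)]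
        least_pure_iterate[OF assms(2,1,4) mc(1,2) _ _ mid mc(3)] C by blast
  qed
  show ?thesis using fwd bwd by blast
qed

end
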